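(* Let $G(z)=\sum_{n\ge0}\frac{(y;q)_n}{(x;q)_n}z^{n}$. Then, as formal power series in $z$, one has the continued fraction expansion \[ \frac{z}{G(z)}=\cfrac{z}{a_1+\cfrac{z}{a_2+\cfrac{z}{a_3+\cfrac{z}{a_4+\cfrac{z}{\ddots}}}}} \] where $a_1=1$ and, for every integer $k\ge1$, \[ a_{2k}=\frac{(x;q)_{k-1}(1-xq^{2k-2})(yq;q)_{k-1}}{(1-y)(yq)^{k-1}(\tfrac xy;q)_{k-1}(q;q)_{k-1}},\qquad a_{2k+1}=-\frac{(1-y)y^{k-1}(\tfrac xy;q)_{k-1}(1-xq^{2k-1})(q;q)_{k-1}}{(x;q)_{k}(yq;q)_{k}}. \]
   Context: For an integer $n\ge0$, $(u;q)_n=(1-u)(1-uq)\cdots(1-uq^{n-1})$ denotes the $q$-Pochhammer symbol, with $(u;q)_0=1$. Here $x,y,q$ are parameters (e.g. indeterminates or generic complex numbers, so that all denominators appearing are nonzero), and $z$ is the variable of the power series. *)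

theory Defs
  imports Complex_Main "HOL-Computational_Algebra.Formal_Power_Series"
begin

definition qpoch :: "'a::comm_ring_1 \<Rightarrow> 'a \<Rightarrow> nat \<Rightarrow> 'a" where
  "qpoch u q n = (\<Prod>i<n. 1 - u * q ^ i)"

(* cf_denom a k n = a k + z/(a (k+1) + z/( ... + z/a (k+n))) *)
fun cf_denom :: "(nat \<Rightarrow> 'a::field) \<Rightarrow> nat \<Rightarrow> nat \<Rightarrow> 'a fps" where
  "cf_denom a k 0 = fps_const (a k)"
| "cf_denom a k (Suc n) = fps_const (a k) + fps_X / cf_denom a (Suc k) n"

(* F = z/(a 1 + z/(a 2 + z/(a 3 + ...))): the finite truncations converge to F in the
   z-adic topology, i.e. the metric topology of the type fps.  Partial denominators are
   required to be nonzero, so that every denominator occurring in a truncation is an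
   invertible power series.  The value a 0 is irrelevant. *)
definition has_cfrac_expansion :: "'a::field fps \<Rightarrow> (nat \<Rightarrow> 'a) \<Rightarrow> bool" where
  "has_cfrac_expansion F a \<longleftrightarrow>
     (\<forall>k\<ge>1. a k \<noteq> 0) \<and> (\<lambda>n. fps_X / cf_denom a 1 n) \<longlonglongrightarrow> F"

end

theory Submission
  imports Defs
begin

text \<open>Heine's contiguous relation
  \<open>\<phi>(a,b;c) = \<phi>(a,bq;cq) + z (c-b)(1-a) / ((1-c)(1-cq)) \<phi>(aq,bq;cq\<^sup>2)\<close>
  makes \<open>G, \<phi>(yq,1;x) = 1, \<phi>(yq,q;xq), \<phi>(yq\<^sup>2,q;xq\<^sup>2), \<phi>(yq\<^sup>2,q\<^sup>2;xq\<^sup>3), \<dots>\<close>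
  a sequence \<open>\<Phi>\<^sub>0, \<Phi>\<^sub>1, \<Phi>\<^sub>2, \<dots>\<close> with \<open>\<Phi>\<^sub>k = \<Phi>\<^sub>k\<^sub>+\<^sub>1 + z d\<^sub>k \<Phi>\<^sub>k\<^sub>+\<^sub>2\<close>.
  Since \<open>a\<^sub>k\<^sub>+\<^sub>1 a\<^sub>k\<^sub>+\<^sub>2 d\<^sub>k = 1\<close>, the series \<open>F\<^sub>k = a\<^sub>k \<Phi>\<^sub>k\<^sub>-\<^sub>1 / \<Phi>\<^sub>k\<close> satisfy
  \<open>F\<^sub>k = a\<^sub>k + z / F\<^sub>k\<^sub>+\<^sub>1\<close>, and each such step gains one power of \<open>z\<close> in the
  agreement of \<open>F\<^sub>1 = G\<close> with the truncations.\<close>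

section \<open>Splitting rules for q-Pochhammer symbols\<close>

lemma qpoch_0 [simp]: "qpoch u q 0 = 1"
  by (simp add: qpoch_def)

lemma qpoch_Suc: "qpoch u q (Suc n) = qpoch u q n * (1 - u * q ^ n)"
  by (simp add: qpoch_def)

lemma qpoch_Suc_left: "qpoch u q (Suc n) = (1 - u) * qpoch (u * q) q n"
  unfolding qpoch_def by (subst prod.lessThan_Suc_shift) (simp add: mult.assoc)

lemma qpoch_add: "qpoch u q (m + n) = qpoch u q m * qpoch (u * q ^ m) q n"
  by (induction n) (simp_all add: qpoch_Suc power_add mult.assoc)

section \<open>From recurrences of power series to convergent continued fractions\<close>

lemma cf_denom_nth_0 [simp]: "fps_nth (cf_denom a k n) 0 = a k"
  if "\<And>k. k \<ge> 1 \<Longrightarrow> a k \<noteq> 0"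
proof (cases n)
  case (Suc m)
  \<comment> \<open>The induction runs from index \<open>Suc k\<close> on, since \<open>a 0\<close>
    may vanish and the tail must be a unit.\<close>
  have "fps_nth (cf_denom a (Suc k) m) 0 = a (Suc k)"
    using that by (induction m arbitrary: k) (simp_all add: fps_divide_unit)
  with that[of "Suc k"] Suc show ?thesis
    by (simp add: fps_divide_unit)
qed simp

text \<open>The difference of the quotients is \<open>fps_X * (g - f) / (f * g)\<close> with
  \<open>f * g\<close> a unit, so the extra factor \<open>fps_X\<close> improves the agreement by
  one order.\<close>

lemma fps_X_divide_diff_dvd:
  fixes f g :: "'a::field fps"
  assumes "fps_nth f 0 \<noteq> 0" "fps_nth g 0 \<noteq> 0" "fps_X ^ n dvd f - g"
  shows "fps_X ^ Suc n dvd fps_X / f - fps_X / g"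
proof -
  have "fps_X / f - fps_X / g = fps_X * inverse f * inverse g * (g - f)"
  proof -
    have "fps_X * inverse f * inverse g * (g - f) =
        fps_X * inverse f * (inverse g * g) - fps_X * inverse g * (inverse f * f)"
      by (simp add: algebra_simps)
    with assms(1,2) show ?thesis
      by (simp add: fps_divide_unit inverse_mult_eq_1)
  qed
  moreover have "fps_X ^ n dvd g - f"
    using assms(3) by (simp add: dvd_diff_commute)
  ultimately show ?thesis
    by (simp add: mult.assoc mult_dvd_mono)
qed

text \<open>\<open>F k\<close> and the truncations starting at \<open>k\<close> unfold by the same
  rule, so their difference is pushed up one order per level; each coefficient is eventually
  constant.\<close>

lemma has_cfrac_expansion_if_recurrence:
  fixes F :: "nat \<Rightarrow> 'a::field fps"
  assumes a: "\<And>k. k \<ge> 1 \<Longrightarrow> a k \<noteq> 0"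
    and F: "\<And>k. k \<ge> 1 \<Longrightarrow> fps_nth (F k) 0 = a k"
    and rec: "\<And>k. k \<ge> 1 \<Longrightarrow> F k = fps_const (a k) + fps_X / F (Suc k)"
  shows "has_cfrac_expansion (fps_X / F 1) a"
proof -
  have approx: "fps_X ^ Suc n dvd cf_denom a k n - F k" if "k \<ge> 1" for k n
    using that
  proof (induction n arbitrary: k)
    \<comment> \<open>Even the truncation without any level is right modulo \<open>fps_X\<close>,
      hence the exponent \<open>Suc n\<close>.\<close>
    case 0
    then show ?case
      using a[of "Suc k"] F[of "Suc k"] by (simp add: rec[of k] fps_divide_unit)
  next
    case (Suc n)
    have "fps_X ^ Suc (Suc n) dvd fps_X / cf_denom a (Suc k) n - fps_X / F (Suc k)"
      by (rule fps_X_divide_diff_dvd) (use Suc.IH[of "Suc k"] a F in simp_all)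
    then show ?case
      using rec[OF Suc.prems] by simp
  qed
  have "fps_nth (fps_X / cf_denom a 1 n) i = fps_nth (fps_X / F 1) i" if "i \<le> n" for i n
  proof -
    have "fps_X ^ Suc (Suc n) dvd fps_X / cf_denom a 1 n - fps_X / F 1"
      by (rule fps_X_divide_diff_dvd) (use approx[of 1 n] a F in simp_all)
    then obtain h where "fps_X / cf_denom a 1 n - fps_X / F 1 = fps_X ^ Suc (Suc n) * h"
      by (elim dvdE)
    then have "fps_nth (fps_X / cf_denom a 1 n - fps_X / F 1) i = 0"
      using that by (simp only: fps_X_power_mult_nth) simp
    then show ?thesis by simp
  qed
  then have "(\<lambda>n. fps_X / cf_denom a 1 n) \<longlonglongrightarrow> fps_X / F 1"
    by (intro tendsto_fpsI eventually_sequentiallyI)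
  then show ?thesis
    using a by (simp add: has_cfrac_expansion_def)
qed

lemma has_cfrac_expansion_if_three_term_recurrence:
  fixes P :: "nat \<Rightarrow> 'a::field fps"
  assumes P: "\<And>k. fps_nth (P k) 0 = 1"
    and rec: "\<And>k. P k = P (Suc k) + fps_const (d k) * fps_X * P (Suc (Suc k))"
    and ad: "\<And>k. a (Suc k) * a (Suc (Suc k)) * d k = 1"
  shows "has_cfrac_expansion (fps_X / (fps_const (a 1) * P 0 / P 1)) a"
proof -
  define F where "F k = fps_const (a k) * P (k - 1) * inverse (P k)" for k
  \<comment> \<open>\<open>a k\<close> is a factor of a product equal to 1.\<close>
  have a: "a k \<noteq> 0" if "k \<ge> 1" for k
    using ad[of "k - 1"] that by auto
  have inv: "P k * inverse (P k) = 1" for k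
    using P[of k] inverse_mult_eq_1'[of "P k"] by simp
  have "has_cfrac_expansion (fps_X / F 1) a"
  proof (rule has_cfrac_expansion_if_recurrence)
    show F0: "fps_nth (F k) 0 = a k" for k
      by (simp add: F_def P)
    show "F k = fps_const (a k) + fps_X / F (Suc k)" if "k \<ge> 1" for k
    proof -
      from that obtain j where k: "k = Suc j"
        by (cases k) auto
      \<comment> \<open>The second factor is the inverse of \<open>F (Suc k)\<close>: by
        \<open>ad\<close> at \<open>j\<close>, the number \<open>a k * d j\<close> is the inverse of
        \<open>a (Suc k)\<close>. Dividing \<open>rec\<close> at \<open>j\<close> by
        \<open>P k\<close> then gives the claim.\<close>
      have "F (Suc k) * (fps_const (a k * d j) * P (Suc k) * inverse (P k)) =
          fps_const (a (Suc k) * a k * d j) * (P k * inverse (P k)) * (P (Suc k) * inverse (P (Suc k)))"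
        by (simp add: F_def ac_simps flip: fps_const_mult)
      also have "\<dots> = 1"
        using ad[of j] by (simp add: inv k ac_simps)
      finally have "inverse (F (Suc k)) = fps_const (a k * d j) * P (Suc k) * inverse (P k)"
        by (metis fps_inverse_unique)
      moreover have "fps_X / F (Suc k) = fps_X * inverse (F (Suc k))"
        using F0[of "Suc k"] a[of "Suc k"] by (simp add: fps_divide_unit)
      moreover have "F k = fps_const (a k) * (P k * inverse (P k)) +
          fps_X * (fps_const (a k * d j) * P (Suc k) * inverse (P k))"
        using rec[of j] by (simp add: F_def k algebra_simps flip: fps_const_mult)
      ultimately show ?thesis
        by (simp add: inv)
    qed
  qed (rule a)
  then show ?thesis
    by (simp add: F_def fps_divide_unit P)
qed

section \<open>Heine's basic hypergeometric series 2phi1 in the variable z, and its contiguous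
  relation\<close>

definition heine_phi :: "'a::field \<Rightarrow> 'a \<Rightarrow> 'a \<Rightarrow> 'a \<Rightarrow> 'a fps" where
  "heine_phi a b c q = Abs_fps (\<lambda>n. qpoch a q n * qpoch b q n / (qpoch c q n * qpoch q q n))"

lemma heine_phi_nth_0 [simp]: "fps_nth (heine_phi a b c q) 0 = 1"
  by (simp add: heine_phi_def)

lemma heine_phi_commute: "heine_phi a b c q = heine_phi b a c q"
  by (simp add: heine_phi_def mult.commute)

lemma heine_phi_1: "heine_phi a 1 c q = 1"
proof (rule fps_ext)
  show "fps_nth (heine_phi a 1 c q) n = fps_nth 1 n" for n
    by (cases n) (simp_all add: heine_phi_def qpoch_Suc_left)
qed

lemma heine_phi_contiguous:
  fixes a b c q :: "'a::field"
  assumes c: "\<And>n. qpoch c q n \<noteq> 0" and q: "\<And>n. qpoch q q n \<noteq> 0"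
  shows "heine_phi a b c q = heine_phi a (b * q) (c * q) q +
    fps_const ((c - b) * (1 - a) / ((1 - c) * (1 - c * q))) * fps_X *
      heine_phi (a * q) (b * q) (c * q ^ 2) q"
proof (rule fps_ext)
  fix n
  show "fps_nth (heine_phi a b c q) n = fps_nth (heine_phi a (b * q) (c * q) q +
    fps_const ((c - b) * (1 - a) / ((1 - c) * (1 - c * q))) * fps_X *
      heine_phi (a * q) (b * q) (c * q ^ 2) q) n"
  proof (cases n)
    case (Suc m)
    define A B C Q t where "A = qpoch (a * q) q m" and "B = qpoch (b * q) q m"
      and "C = qpoch (c * q) q m" and "Q = qpoch q q m" and "t = q ^ Suc m"
    \<comment> \<open>Both sides are \<open>qpoch (c * q) q (Suc m)\<close>, with the first or the
      last factor split off.\<close>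
    have C2: "(1 - c * q) * qpoch (c * q ^ 2) q m = C * (1 - c * t)"
      using qpoch_Suc_left[of "c * q" q m] qpoch_Suc[of "c * q" q m]
      by (simp add: C_def t_def power2_eq_square mult.assoc)
    have nz: "1 - c \<noteq> 0" "C \<noteq> 0" "1 - c * t \<noteq> 0" "Q \<noteq> 0" "1 - t \<noteq> 0"
      using c[of "Suc m"] c[of "Suc (Suc m)"] q[of "Suc m"]
      by (simp_all add: qpoch_Suc_left[of c] qpoch_Suc[of "c * q"] qpoch_Suc[of q]
          C_def Q_def t_def mult.assoc)
    \<comment> \<open>After clearing denominators this is \<open>(1 - b) * (1 - c * t) = (1 - b * t)
      * (1 - c) + (c - b) * (1 - t)\<close>.\<close>
    have "(1 - a) * A * ((1 - b) * B) / ((1 - c) * C * (Q * (1 - t))) =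
        (1 - a) * A * (B * (1 - b * t)) / (C * (1 - c * t) * (Q * (1 - t))) +
        (c - b) * (1 - a) * (A * B) / ((1 - c) * (C * (1 - c * t)) * Q)"
      using nz by (simp add: divide_simps) algebra
    also have "(1 - c) * (C * (1 - c * t)) * Q =
        (1 - c) * (1 - c * q) * (qpoch (c * q ^ 2) q m * Q)"
      by (simp add: C2[symmetric] mult.assoc)
    finally show ?thesis
      by (simp add: Suc heine_phi_def mult.assoc[of "fps_const _" fps_X]
          qpoch_Suc_left[of a] qpoch_Suc_left[of b] qpoch_Suc_left[of c]
          qpoch_Suc[of "b * q"] qpoch_Suc[of "c * q"] qpoch_Suc[of q]
          A_def B_def C_def Q_def t_def mult.assoc)
  qed simp
qed

section \<open>Verification for \<open>G\<close>: cancelling partial denominators and assembling the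
  fraction\<close>

lemma cancel_even_odd:
  fixes X :: "'a::field"
  assumes "X \<noteq> 0" "Y \<noteq> 0" "Z \<noteq> 0" "Q \<noteq> 0" "e \<noteq> 0" "p \<noteq> 0"
  shows "X * r * Y / (e * (p * t) * Z * Q) * - (e * p * Z * s * Q / (X * u * (Y * v))) =
    - (r * s / (t * u * v))"
  using assms by (simp add: field_simps)

lemma cancel_odd_even:
  fixes X :: "'a::field"
  assumes "X \<noteq> 0" "Y \<noteq> 0" "Z \<noteq> 0" "Q \<noteq> 0" "e \<noteq> 0" "p \<noteq> 0"
  shows "- (e * p * Z * s * Q / (X * Y)) * (X * r * Y / (e * (y * p * t) * (Z * u) * (Q * v))) =
    - (s * r / (y * t * u * v))"
  using assms by (simp add: field_simps)

theorem mainTheorem1: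
  fixes x y q :: "'a::field" and a :: "nat \<Rightarrow> 'a" and G :: "'a fps"
  assumes "q \<noteq> 0" and "y \<noteq> 0" and "y \<noteq> 1"
    and "\<And>n. qpoch x q n \<noteq> 0"
    and "\<And>n. qpoch (y * q) q n \<noteq> 0"
    and "\<And>n. qpoch (x / y) q n \<noteq> 0"
    and "\<And>n. qpoch q q n \<noteq> 0"
    and "G = Abs_fps (\<lambda>n. qpoch y q n / qpoch x q n)"
    and "a 1 = 1"
    and "\<And>k. k \<ge> 1 \<Longrightarrow> a (2 * k) =
           (qpoch x q (k - 1) * (1 - x * q ^ (2 * k - 2)) * qpoch (y * q) q (k - 1)) /
           ((1 - y) * (y * q) ^ (k - 1) * qpoch (x / y) q (k - 1) * qpoch q q (k - 1))"
    and "\<And>k. k \<ge> 1 \<Longrightarrow> a (2 * k + 1) =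
           - (((1 - y) * y ^ (k - 1) * qpoch (x / y) q (k - 1) * (1 - x * q ^ (2 * k - 1))
                * qpoch q q (k - 1)) /
              (qpoch x q k * qpoch (y * q) q k))"
  shows "has_cfrac_expansion (fps_X / G) a"
proof -
  note q0 = assms(1) and y0 = assms(2) and y1 = assms(3)
    and qx = assms(4) and qyq = assms(5) and qxy = assms(6) and qq = assms(7)
    and G = assms(8) and a1 = assms(9) and a_even = assms(10) and a_odd = assms(11)
  have x_nz: "1 - x * q ^ i \<noteq> 0" for i
    using qx[of "Suc i"] by (simp add: qpoch_Suc)
  have yq_nz: "1 - y * q * q ^ i \<noteq> 0" for i
    using qyq[of "Suc i"] by (simp add: qpoch_Suc)
  have xy_nz: "y - x * q ^ i \<noteq> 0" for i
    using qxy[of "Suc i"] y0 by (auto simp: qpoch_Suc field_simps)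
  have q_nz: "1 - q * q ^ i \<noteq> 0" for i
    using qq[of "Suc i"] by (simp add: qpoch_Suc)
  have qx': "qpoch (x * q ^ i) q n \<noteq> 0" for i n
    using qx[of "i + n"] by (simp add: qpoch_add)
  \<comment> \<open>The case \<open>k = 0\<close> is separate because the general formula would give
    1 there instead of \<open>G\<close>.\<close>
  define P where "P k = (if k = 0 then G
      else heine_phi (y * q ^ ((k + 1) div 2)) (q ^ (k div 2)) (x * q ^ (k - 1)) q)" for k
  \<comment> \<open>For \<open>k > 0\<close> this is the coefficient of the contiguous relation; the
    parity of \<open>k\<close> decides which numerator parameter plays the role of
    \<open>b\<close>.\<close>
  define d where "d k = (if k = 0 then (1 - y) / (1 - x)
      else let m = k div 2 in
        (if even k then (x * q ^ (k - 1) - y * q ^ m) * (1 - q ^ m)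
         else (x * q ^ (k - 1) - q ^ m) * (1 - y * q ^ Suc m)) /
        ((1 - x * q ^ (k - 1)) * (1 - x * q ^ k)))" for k
  have nat_cases: "k = 0 \<or> (\<exists>m. k = 2 * m + 1) \<or> (\<exists>m. k = 2 * m + 2)" for k :: nat
    by presburger
  have "has_cfrac_expansion (fps_X / (fps_const (a 1) * P 0 / P 1)) a"
  proof (rule has_cfrac_expansion_if_three_term_recurrence)
    show "fps_nth (P k) 0 = 1" for k
      by (simp add: P_def G)
    show "P k = P (Suc k) + fps_const (d k) * fps_X * P (Suc (Suc k))" for k
    proof -
      consider "k = 0" | m where "k = 2 * m + 1" | m where "k = 2 * m + 2"
        using nat_cases[of k] by blast
      then show ?thesis
      proof cases
        case 1
        \<comment> \<open>Splitting off the first factors of \<open>qpoch y q n\<close> and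
          \<open>qpoch x q n\<close> suffices here; the parameter \<open>q\<close> cancels the
          \<open>qpoch q q n\<close> of the Heine series.\<close>
        have "G = 1 + fps_const ((1 - y) / (1 - x)) * fps_X * heine_phi (y * q) q (x * q) q"
        proof (rule fps_ext)
          show "fps_nth G n = fps_nth
            (1 + fps_const ((1 - y) / (1 - x)) * fps_X * heine_phi (y * q) q (x * q) q) n" for n
            using qq by (cases n) (simp_all add: G heine_phi_def qpoch_Suc_left mult.assoc)
        qed
        with 1 show ?thesis
          by (simp add: P_def d_def heine_phi_1)
      next
        case (2 m)
        with heine_phi_contiguous[OF qx' qq, of "y * q ^ Suc m" "q ^ m" "2 * m"]
        show ?thesis
          by (simp add: P_def d_def ac_simps power2_eq_square)
      next
        case (3 m)
        \<comment> \<open>The contiguous relation raises the second parameter in its first term. Now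
          the one with \<open>y\<close> must rise, so the numerator parameters are swapped before
          and after.\<close>
        with heine_phi_contiguous[OF qx' qq, of "q ^ Suc m" "y * q ^ Suc m" "2 * m + 1",
            unfolded heine_phi_commute[of "q ^ Suc m"] heine_phi_commute[of "q ^ Suc m * q"]]
        show ?thesis
          by (simp add: P_def d_def ac_simps power2_eq_square)
      qed
    qed
    have a_even': "a (2 * m + 2) = qpoch x q m * (1 - x * q ^ (2 * m)) * qpoch (y * q) q m /
        ((1 - y) * (y * q) ^ m * qpoch (x / y) q m * qpoch q q m)" for m
      using a_even[of "Suc m"] by simp
    have a_odd': "a (2 * m + 3) =
        - ((1 - y) * y ^ m * qpoch (x / y) q m * (1 - x * q ^ (2 * m + 1)) * qpoch q q m /
          (qpoch x q (Suc m) * qpoch (y * q) q (Suc m)))" for m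
      using a_odd[of "Suc m"] by (simp add: eval_nat_numeral)
    show "a (Suc k) * a (Suc (Suc k)) * d k = 1" for k
    proof -
      consider "k = 0" | m where "k = 2 * m + 1" | m where "k = 2 * m + 2"
        using nat_cases[of k] by blast
      then show ?thesis
      proof cases
        case 1
        then show ?thesis
          using a1 a_even'[of 0] y1 x_nz[of 0] by (simp add: d_def numeral_2_eq_2)
      next
        case (2 m)
        \<comment> \<open>All symbols of length \<open>m\<close> cancel; only the last factors of
          \<open>qpoch x q (Suc m)\<close> and \<open>qpoch (y * q) q (Suc m)\<close> remain, and
          \<open>(y * q) ^ m\<close> leaves \<open>q ^ m\<close>.\<close>
        have "a (2 * m + 2) * a (2 * m + 3) =
            - ((1 - x * q ^ (2 * m)) * (1 - x * q ^ (2 * m + 1)) /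
               (q ^ m * (1 - x * q ^ m) * (1 - y * q * q ^ m)))"
          unfolding a_even' a_odd' qpoch_Suc power_mult_distrib
          by (rule cancel_even_odd) (use qx qyq qxy qq y0 y1 in simp_all)
        moreover have "(x * q ^ (2 * m) - q ^ m) * (1 - y * q ^ Suc m) =
            - (q ^ m * (1 - x * q ^ m) * (1 - y * q * q ^ m))"
          by (simp add: algebra_simps power_add mult_2_right)
        then have "d k = - (q ^ m * (1 - x * q ^ m) * (1 - y * q * q ^ m) /
            ((1 - x * q ^ (2 * m)) * (1 - x * q ^ (2 * m + 1))))"
          by (simp add: 2 d_def)
        moreover have "q ^ m * (1 - x * q ^ m) * (1 - y * q * q ^ m) \<noteq> 0"
          "(1 - x * q ^ (2 * m)) * (1 - x * q ^ (2 * m + 1)) \<noteq> 0"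
          using q0 x_nz yq_nz by (simp_all del: power_Suc)
        ultimately show ?thesis
          by (simp add: 2 eval_nat_numeral)
      next
        case (3 m)
        have "a (2 * m + 3) * a (2 * m + 4) =
            - ((1 - x * q ^ (2 * m + 1)) * (1 - x * q ^ (2 * m + 2)) /
               (y * q ^ Suc m * (1 - x / y * q ^ m) * (1 - q * q ^ m)))"
        proof -
          \<comment> \<open>Only the symbols in \<open>x / y\<close> and \<open>q\<close> are split,
            to match length \<open>m\<close> in \<open>a (2 * m + 3)\<close>; those in
            \<open>x\<close> and \<open>y * q\<close> have length \<open>Suc m\<close> in both and
            cancel whole.\<close>
          have "a (2 * m + 4) =
              qpoch x q (Suc m) * (1 - x * q ^ (2 * m + 2)) * qpoch (y * q) q (Suc m) /
              ((1 - y) * (y * y ^ m * q ^ Suc m) * (qpoch (x / y) q m * (1 - x / y * q ^ m)) *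
                (qpoch q q m * (1 - q * q ^ m)))"
            using a_even'[of "Suc m"]
            by (simp add: eval_nat_numeral power_mult_distrib qpoch_Suc[of "x / y"] qpoch_Suc[of q])
          then show ?thesis
            unfolding a_odd' by (simp only:) (rule cancel_odd_even; use qx qyq qxy qq y0 y1 in simp)
        qed
        \<comment> \<open>The spare \<open>y\<close> clears the fraction \<open>x / y\<close>,
          giving the numerator of \<open>d k\<close> up to sign.\<close>
        also have "y * q ^ Suc m * (1 - x / y * q ^ m) = q ^ Suc m * (y - x * q ^ m)"
          using y0 by (simp add: field_simps)
        finally have "a (2 * m + 3) * a (2 * m + 4) =
            - ((1 - x * q ^ (2 * m + 1)) * (1 - x * q ^ (2 * m + 2)) /
               (q ^ Suc m * (y - x * q ^ m) * (1 - q * q ^ m)))" .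
        moreover have "(x * q ^ (2 * m + 1) - y * q ^ Suc m) * (1 - q ^ Suc m) =
            - (q ^ Suc m * (y - x * q ^ m) * (1 - q * q ^ m))"
          by (simp add: algebra_simps power_add mult_2_right)
        then have "d k = - (q ^ Suc m * (y - x * q ^ m) * (1 - q * q ^ m) /
            ((1 - x * q ^ (2 * m + 1)) * (1 - x * q ^ (2 * m + 2))))"
          by (simp add: 3 d_def)
        moreover have "q ^ Suc m * (y - x * q ^ m) * (1 - q * q ^ m) \<noteq> 0"
          "(1 - x * q ^ (2 * m + 1)) * (1 - x * q ^ (2 * m + 2)) \<noteq> 0"
          using q0 x_nz xy_nz q_nz by (simp_all del: power_Suc)
        ultimately show ?thesis
          by (simp add: 3 eval_nat_numeral)
      qed
    qed
  qed
  \<comment> \<open>\<open>P 1 = 1\<close> because its second parameter is \<open>q ^ 0\<close>, so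
    the quotient is \<open>G\<close>.\<close>
  then show ?thesis
    using a1 by (simp add: P_def heine_phi_1)
qed

end
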